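(* There exists an absolute constant $c>0$ such that the following holds. Let $M$ be a prime power and $\varepsilon\in(0,1/4)$, $\alpha\ge1$ real numbers. For all integers $t$ and $N$ with $\varepsilon\cdot M^{t-1}\ge1$ and $N\ge 6\varepsilon M^{2t}$, and for $T=\lceil\varepsilon^2M^{2t-1}\log(\alpha/\varepsilon)\rceil$, there exist an integer $K\ge c\,MT/(\varepsilon\log(\alpha/\varepsilon))$, a $2$-universal family $\mathcal{H}$ of hash functions $[N]\to[M]$, and a block $K$-source $\mathbf{X}=(X_1,\dots,X_T)$ over $[N]^T$ such that, with $H$ uniform over $\mathcal{H}$ and independent of $\mathbf{X}$, $(H,\mathbf{Y})=(H,H(X_1),\dots,H(X_T))$ is $\varepsilon$-far in statistical distance from every distribution $(H',\mathbf{Z})$ on $\mathcal{H}\times[M]^T$ with $\mathrm{cp}(H',\mathbf{Z})\le\alpha/(|\mathcal{H}|\cdot M^T)$.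
   Context: $[n]=\{1,\dots,n\}$. A hash family is a multiset of functions $[N]\to[M]$; it is $2$-universal if for all distinct $x_1,x_2$, $\Pr_H[H(x_1)=H(x_2)]\le1/M$. $\mathrm{cp}(X)=\sum_x\Pr[X=x]^2$. A sequence $(X_1,\dots,X_T)$ over $[N]^T$ is a block $K$-source if for every $i$ and every $x_{<i}$ in the support of $(X_1,\dots,X_{i-1})$, $\mathrm{cp}(X_i\mid X_{<i}=x_{<i})\le 1/K$. Statistical distance: $\Delta(X,Y)=\max_S|\Pr[X\in S]-\Pr[Y\in S]|$; $\varepsilon$-far means $\Delta\ge\varepsilon$. Logarithms are base $2$. *)

theory Defs
  imports "HOL-Probability.Probability" "HOL-Number_Theory.Prime_Powers"
begin

text \<open>
  Random variables with finite range are given by their distributions, as values of type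
  \<^typ>\<open>'a pmf\<close>. The set $[n]$ is \<^term>\<open>{1..n}\<close>, and $[n]^T$ consists of lists; the list
  index of the \<open>i\<close>-th component, counted from \<open>1\<close>, is \<open>i - 1\<close>.
\<close>

definition tuples :: "nat \<Rightarrow> nat \<Rightarrow> nat list set" where
  "tuples n T = {xs. length xs = T \<and> set xs \<subseteq> {1..n}}"

text \<open>
  The infinite sum always converges (see \<open>cp_summable\<close>), so this is the sum of the squared
  point masses whether or not the support is finite.
\<close>

definition cp :: "'a pmf \<Rightarrow> real" where
  "cp p = (\<Sum>\<^sub>\<infinity>x. (pmf p x)\<^sup>2)"

text \<open>The supremum is over a nonempty set of reals bounded by \<open>1\<close>.\<close>

definition stat_dist :: "'a pmf \<Rightarrow> 'a pmf \<Rightarrow> real" where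
  "stat_dist p q = (SUP S. \<bar>measure_pmf.prob p S - measure_pmf.prob q S\<bar>)"

text \<open>
  Here \<^term>\<open>take i\<close> maps $(x_1, \dots, x_T)$ to $(x_1, \dots, x_i)$, and the component that
  follows this prefix is \<open>xs ! i\<close>.
\<close>

definition block_source :: "nat \<Rightarrow> nat \<Rightarrow> nat \<Rightarrow> nat list pmf \<Rightarrow> bool" where
  "block_source N T K X \<longleftrightarrow>
     set_pmf X \<subseteq> tuples N T \<and>
     (\<forall>i<T. \<forall>ys \<in> set_pmf (map_pmf (take i) X).
        cp (map_pmf (\<lambda>xs. xs ! i) (cond_pmf X {xs. take i xs = ys})) \<le> 1 / real K)"

definition hash_family :: "nat \<Rightarrow> nat \<Rightarrow> (nat \<Rightarrow> nat) multiset \<Rightarrow> bool" where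
  "hash_family N M \<H> \<longleftrightarrow> \<H> \<noteq> {#} \<and> set_mset \<H> \<subseteq> {1..N} \<rightarrow>\<^sub>E {1..M}"

definition two_universal :: "nat \<Rightarrow> nat \<Rightarrow> (nat \<Rightarrow> nat) multiset \<Rightarrow> bool" where
  "two_universal N M \<H> \<longleftrightarrow>
     hash_family N M \<H> \<and>
     (\<forall>x1\<in>{1..N}. \<forall>x2\<in>{1..N}. x1 \<noteq> x2 \<longrightarrow>
        measure_pmf.prob (pmf_of_multiset \<H>) {h. h x1 = h x2} \<le> 1 / real M)"

text \<open>
  The members of a multiset as pairwise distinguishable objects: a function \<open>h\<close> of multiplicity
  \<open>m\<close> contributes the members \<open>(h, 0), \<dots>, (h, m - 1)\<close>. Distributions on $\mathcal{H} \times [M]^T$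
  are distributions on \<^term>\<open>members \<H> \<times> tuples M T\<close>, so that a uniform member together
  with an independent uniform tuple has collision probability exactly $1/(|\mathcal{H}| M^T)$.
  If equal functions were identified, repeating every function of a family sufficiently often
  would rule out all distributions of collision probability at most
  $\alpha/(|\mathcal{H}| M^T)$.
\<close>

definition members :: "'a multiset \<Rightarrow> ('a \<times> nat) set" where
  "members A = (SIGMA x:set_mset A. {..<count A x})"

definition hashed :: "(nat \<Rightarrow> nat) multiset \<Rightarrow> nat list pmf \<Rightarrow> (((nat \<Rightarrow> nat) \<times> nat) \<times> nat list) pmf"
  where
  "hashed \<H> X =
     map_pmf (\<lambda>(H, xs). (H, map (fst H) xs)) (pair_pmf (pmf_of_set (members \<H>)) X)"

lemma cp_summable: "(\<lambda>x. (pmf p x)\<^sup>2) summable_on UNIV"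
proof (rule summable_on_comparison_test)
  show "pmf p summable_on UNIV"
    using pmf_abs_summable[of p UNIV] abs_summable_equivalent[of "pmf p" UNIV]
      abs_summable_summable[of "pmf p" UNIV] by blast
  show "(pmf p x)\<^sup>2 \<le> pmf p x" for x
    using mult_left_le[OF pmf_le_1 pmf_nonneg, of p x p x] by (simp add: power2_eq_square)
qed simp

lemma stat_dist_bdd_above:
  "bdd_above (range (\<lambda>S. \<bar>measure_pmf.prob p S - measure_pmf.prob q S\<bar>))"
proof (rule bdd_aboveI2)
  fix S
  show "\<bar>measure_pmf.prob p S - measure_pmf.prob q S\<bar> \<le> 1"
    using measure_pmf.prob_le_1[of p S] measure_pmf.prob_le_1[of q S]
      measure_nonneg[of p S] measure_nonneg[of q S] by linarith
qed

lemma finite_members: "finite (members A)"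
  by (simp add: members_def)

lemma card_members: "card (members A) = size A"
  by (simp add: members_def size_multiset_overloaded_eq)

lemma map_fst_members:
  assumes "A \<noteq> {#}"
  shows "map_pmf fst (pmf_of_set (members A)) = pmf_of_multiset A"
proof (rule pmf_eqI)
  fix x
  have ne: "members A \<noteq> {}"
    using assms card_members[of A] by auto
  have "fst -` {x} \<inter> members A = {x} \<times> {..<count A x}"
    by (cases "x \<in># A") (auto simp: members_def not_in_iff)
  then have "card (members A \<inter> fst -` {x}) = count A x"
    by (simp add: Int_commute card_cartesian_product)
  then show "pmf (map_pmf fst (pmf_of_set (members A))) x = pmf (pmf_of_multiset A) x"
    using assms ne by (simp add: pmf_map measure_pmf_of_set finite_members card_members)
qed

end

theory Submission
  imports Defs "HOL-Combinatorics.Transposition"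
begin

text \<open>
  Let every block be uniform on \<open>{1..K}\<close> with \<open>K = M * k\<close>. With probability \<open>1 - 1 / m\<close>, where
  \<open>1 / m\<close> is at least \<open>2 * \<epsilon>\<close> and of that order, the hash function is a random perfectly balanced
  function on \<open>{1..K}\<close>. Such a function has fewer colliding pairs than 2-universality permits, and
  the savings allow it, in the remaining cases, to be biased: \<open>a = M div 2\<close> symbols have \<open>k + d\<close>
  preimages and \<open>a\<close> others have \<open>k - d\<close>, provided that \<open>2 * d\<^sup>2 \<le> m * k\<close>. Values outside \<open>{1..K}\<close>
  are uniform and independent. After \<open>T\<close> independent blocks the bias has accumulated enough for the
  hashed tuple to lie, with probability near \<open>1\<close>, in a set of density at most about \<open>\<epsilon> / \<alpha>\<close>. By
  Cauchy-Schwarz a distribution of small collision probability gives the event that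
  the function is biased and the tuple lies in this set a probability smaller by at least \<open>\<epsilon>\<close>.
\<close>

subsection \<open>Uniform tuples, collision probability and block sources\<close>

lemma tuples_0: "tuples n 0 = {[]}"
  by (auto simp: tuples_def)

lemma tuples_Suc: "tuples n (Suc T) = (\<lambda>(x, xs). x # xs) ` ({1..n} \<times> tuples n T)"
  by (auto simp: tuples_def image_iff length_Suc_conv)

lemma finite_tuples: "finite (tuples n T)"
  using finite_lists_length_eq[of "{1..n}" T] by (simp add: tuples_def conj_commute)

lemma card_tuples: "card (tuples n T) = n ^ T"
  using card_lists_length_eq[of "{1..n}" T] by (simp add: tuples_def conj_commute)

lemma tuples_nonempty: "n > 0 \<Longrightarrow> tuples n T \<noteq> {}"
  using card_tuples[of n T] by force

text \<open>Distributivity. It factors the exponential moment of a sum over independent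
  coordinates.\<close>

lemma sum_prod_list_tuples:
  fixes g :: "nat \<Rightarrow> 'a :: comm_semiring_1"
  shows "(\<Sum>xs\<in>tuples n T. prod_list (map g xs)) = (\<Sum>x=1..n. g x) ^ T"
proof (induction T)
  case (Suc T)
  have "(\<Sum>xs\<in>tuples n (Suc T). prod_list (map g xs)) =
      (\<Sum>(x, xs)\<in>{1..n} \<times> tuples n T. g x * prod_list (map g xs))"
    unfolding tuples_Suc by (subst sum.reindex) (auto simp: inj_on_def intro!: sum.cong)
  also have "\<dots> = (\<Sum>x=1..n. g x) * (\<Sum>xs\<in>tuples n T. prod_list (map g xs))"
    by (simp add: sum_product sum.cartesian_product)
  finally show ?case by (simp add: Suc.IH)
qed (simp add: tuples_0)

lemma pair_pmf_of_set:
  assumes "finite A" "A \<noteq> {}" "finite B" "B \<noteq> {}"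
  shows "pair_pmf (pmf_of_set A) (pmf_of_set B) = pmf_of_set (A \<times> B)"
proof (rule pmf_eqI)
  fix x :: "'a \<times> 'b"
  show "pmf (pair_pmf (pmf_of_set A) (pmf_of_set B)) x = pmf (pmf_of_set (A \<times> B)) x"
    using assms by (cases x) (simp add: pmf_pair card_cartesian_product indicator_def)
qed

lemma cond_pmf_of_set:
  assumes "finite A" "A \<inter> S \<noteq> {}"
  shows "cond_pmf (pmf_of_set A) S = pmf_of_set (A \<inter> S)"
proof (rule pmf_eqI)
  fix x
  have "A \<noteq> {}" "card (A \<inter> S) > 0" using assms by (auto simp: card_gt_0_iff)
  then show "pmf (cond_pmf (pmf_of_set A) S) x = pmf (pmf_of_set (A \<inter> S)) x"
    using assms by (auto simp: pmf_cond measure_pmf_of_set indicator_def)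
qed

lemma measure_pmf_of_multiset:
  assumes "A \<noteq> {#}"
  shows "measure_pmf.prob (pmf_of_multiset A) E = real (size (filter_mset (\<lambda>x. x \<in> E) A)) / real (size A)"
proof -
  have "measure_pmf.prob (pmf_of_multiset A) E = measure_pmf.prob (pmf_of_multiset A) (E \<inter> set_mset A)"
    using assms measure_Int_set_pmf[of "pmf_of_multiset A" E] by simp
  also have "\<dots> = (\<Sum>x\<in>E \<inter> set_mset A. real (count A x) / real (size A))"
    using assms by (subst measure_measure_pmf_finite) auto
  also have "\<dots> = real (\<Sum>x\<in>E \<inter> set_mset A. count A x) / real (size A)"
    by (simp add: sum_divide_distrib)
  also have "(\<Sum>x\<in>E \<inter> set_mset A. count A x) = size (filter_mset (\<lambda>x. x \<in> E) A)"
    by (auto simp: size_multiset_overloaded_eq intro!: sum.cong)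
  finally show ?thesis .
qed

lemma members_filter: "members (filter_mset P A) = {H \<in> members A. P (fst H)}"
  by (auto simp: members_def not_in_iff[symmetric])

text \<open>Cauchy-Schwarz against the indicator of \<open>S\<close>; this is how a bound on
  collision probability becomes a bound on probabilities.\<close>

lemma prob_le_sqrt_card_cp:
  assumes "finite S"
  shows "measure_pmf.prob Q S \<le> sqrt (real (card S) * cp Q)"
proof -
  have "(\<Sum>x\<in>S. 1 * pmf Q x)\<^sup>2 \<le> (\<Sum>x\<in>S. 1\<^sup>2) * (\<Sum>x\<in>S. (pmf Q x)\<^sup>2)"
    by (rule Cauchy_Schwarz_ineq_sum)
  also have "\<dots> \<le> real (card S) * cp Q"
    using finite_sum_le_infsum[OF cp_summable assms, of Q]
    by (auto simp: cp_def intro!: mult_left_mono)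
  finally have "(measure_pmf.prob Q S)\<^sup>2 \<le> real (card S) * cp Q"
    using assms by (simp add: measure_measure_pmf_finite)
  then show ?thesis by (rule real_le_rsqrt)
qed

lemma stat_dist_ge: "measure_pmf.prob p S - measure_pmf.prob q S \<le> stat_dist p q"
proof -
  have "\<bar>measure_pmf.prob p S - measure_pmf.prob q S\<bar> \<le> stat_dist p q"
    unfolding stat_dist_def by (intro cSUP_upper stat_dist_bdd_above) auto
  then show ?thesis by linarith
qed

lemma cp_pmf_of_set:
  assumes "finite A" "A \<noteq> {}"
  shows "cp (pmf_of_set A) = 1 / real (card A)"
proof -
  have "cp (pmf_of_set A) = (\<Sum>\<^sub>\<infinity>x\<in>A. (1 / real (card A))\<^sup>2)"
    unfolding cp_def using assms by (intro infsum_cong_neutral) (auto simp: indicator_def)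
  also have "\<dots> = 1 / real (card A)"
    using assms by (simp add: power2_eq_square)
  finally show ?thesis .
qed

text \<open>Fixing a prefix of length \<open>i\<close> leaves an injective image of the product
  \<open>D\<close>, so the next coordinate is again uniform on \<open>{1..K}\<close>.\<close>

lemma block_source_uniform:
  assumes "0 < K" "K \<le> N"
  shows "block_source N T K (pmf_of_set (tuples K T))"
  unfolding block_source_def
proof (intro conjI allI impI ballI)
  note ft = finite_tuples and ne = tuples_nonempty[OF assms(1)]
  show "set_pmf (pmf_of_set (tuples K T)) \<subseteq> tuples N T"
    using assms ft ne by (auto simp: tuples_def)
  fix i ys
  assume i: "i < T" and "ys \<in> set_pmf (map_pmf (take i) (pmf_of_set (tuples K T)))"
  then obtain xs where xs: "xs \<in> tuples K T" "take i xs = ys" using ft ne by auto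
  have ys: "length ys = i" "set ys \<subseteq> {1..K}"
    using xs i set_take_subset[of i xs] by (auto simp: tuples_def)
  define F where "F = (\<lambda>(v, zs). ys @ v # zs)"
  define D where "D = {1..K} \<times> tuples K (T - Suc i)"
  have eq: "tuples K T \<inter> {xs. take i xs = ys} = F ` D"
  proof (intro equalityI subsetI)
    fix us assume us: "us \<in> tuples K T \<inter> {xs. take i xs = ys}"
    have "us = ys @ us ! i # drop (Suc i) us" 
      using us id_take_nth_drop[of i us] i by (auto simp: tuples_def)
    have "set us \<subseteq> {1..K}" "length us = T"
      using us by (auto simp: tuples_def)
    moreover from this have "us ! i \<in> set us" using i by simp
    ultimately have "us ! i \<in> {1..K}" "drop (Suc i) us \<in> tuples K (T - Suc i)"
      using set_drop_subset[of "Suc i" us] by (blast, auto simp: tuples_def)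
    with \<open>us = _\<close> show "us \<in> F ` D"
      unfolding F_def D_def by (intro image_eqI[of _ _ "(us ! i, drop (Suc i) us)"]) auto
  qed (use ys i in \<open>auto simp: F_def D_def tuples_def subset_iff\<close>)
  have fD: "finite D" "D \<noteq> {}"
    using assms tuples_nonempty[OF assms(1)] finite_tuples by (auto simp: D_def)
  have "cond_pmf (pmf_of_set (tuples K T)) {xs. take i xs = ys} = pmf_of_set (F ` D)"
    using xs ft ne eq by (subst cond_pmf_of_set) auto
  also have "\<dots> = map_pmf F (pmf_of_set D)"
    using fD by (intro map_pmf_of_set_inj[symmetric]) (auto simp: inj_on_def F_def)
  finally have "map_pmf (\<lambda>xs. xs ! i) (cond_pmf (pmf_of_set (tuples K T)) {xs. take i xs = ys})
      = map_pmf (\<lambda>(v, zs). v) (pmf_of_set D)"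
    using ys by (simp add: pmf.map_comp o_def F_def case_prod_unfold nth_append)
  also have "\<dots> = pmf_of_set {1..K}"
    unfolding D_def using assms finite_tuples tuples_nonempty[OF assms(1)]
    by (subst pair_pmf_of_set[symmetric]) (auto simp: map_fst_pair_pmf case_prod_unfold)
  finally show "cp (map_pmf (\<lambda>xs. xs ! i) (cond_pmf (pmf_of_set (tuples K T)) {xs. take i xs = ys}))
      \<le> 1 / real K"
    using assms by (simp add: cp_pmf_of_set)
qed

subsection \<open>Concentration of sums over uniform tuples\<close>

lemma exp_sum_list_map: "exp (sum_list (map (f :: nat \<Rightarrow> real) xs)) = prod_list (map (\<lambda>x. exp (f x)) xs)"
  by (induction xs) (auto simp: exp_add)

text \<open>Hoeffding's lemma: the values lie in an interval of length \<open>2\<close>, so the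
  quadratic term of the exponent is \<theta> squared times \<open>2^2 / 8\<close>.\<close>

lemma sum_exp_le:
  fixes f :: "nat \<Rightarrow> real"
  assumes n: "n > 0" and f: "\<And>x. x \<in> {1..n} \<Longrightarrow> \<bar>f x\<bar> \<le> 1"
    and mean: "(\<Sum>x=1..n. f x) = real n * \<mu>" and "\<theta> > 0"
  shows "(\<Sum>x=1..n. exp (\<theta> * f x)) \<le> real n * exp (\<theta> * \<mu> + \<theta>\<^sup>2 / 2)"
proof -
  let ?U = "pmf_of_set {1..n}"
  have ne: "{1..n} \<noteq> {}" using n by auto
  interpret interval_bounded_random_variable ?U f "-1" 1
  proof unfold_locales
    have "f x \<in> {-1..1}" if "x \<in> {1..n}" for x using f[OF that] by auto
    then show "AE x in ?U. f x \<in> {-1..1}"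
      using ne by (simp add: AE_measure_pmf_iff)
  qed simp
  have "measure_pmf.expectation ?U f = \<mu>"
    using mean n ne by (simp add: integral_pmf_of_set)
  then have "(\<integral>\<^sup>+x. ennreal (exp (\<theta> * (f x - \<mu>))) \<partial>?U) \<le> ennreal (exp (\<theta>\<^sup>2 * (1 - (-1))\<^sup>2 / 8))"
    using Hoeffdings_lemma_nn_integral[OF \<open>\<theta> > 0\<close>] by simp
  also have "(\<integral>\<^sup>+x. ennreal (exp (\<theta> * (f x - \<mu>))) \<partial>?U) =
      ennreal (measure_pmf.expectation ?U (\<lambda>x. exp (\<theta> * (f x - \<mu>))))"
    using n ne by (intro nn_integral_eq_integral integrable_measure_pmf_finite) auto
  finally have "measure_pmf.expectation ?U (\<lambda>x. exp (\<theta> * (f x - \<mu>))) \<le> exp (\<theta>\<^sup>2 / 2)"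
    by simp
  then have "(\<Sum>x=1..n. exp (\<theta> * (f x - \<mu>))) \<le> real n * exp (\<theta>\<^sup>2 / 2)"
    using n ne by (simp add: integral_pmf_of_set field_simps)
  then have "exp (\<theta> * \<mu>) * (\<Sum>x=1..n. exp (\<theta> * (f x - \<mu>))) \<le> exp (\<theta> * \<mu>) * (real n * exp (\<theta>\<^sup>2 / 2))"
    by (intro mult_left_mono) auto
  then show ?thesis
    by (simp add: sum_distrib_left right_diff_distrib exp_diff exp_add mult.left_commute)
qed

lemma card_tuples_sum_ge:
  fixes f :: "nat \<Rightarrow> real"
  assumes n: "n > 0" and f: "\<And>x. x \<in> {1..n} \<Longrightarrow> \<bar>f x\<bar> \<le> 1"
    and mean: "(\<Sum>x=1..n. f x) = real n * \<mu>" and "T > 0" "y > 0"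
  shows "real (card {xs \<in> tuples n T. sum_list (map f xs) \<ge> real T * (\<mu> + y)})
    \<le> real n ^ T * exp (- real T * y\<^sup>2 / 2)"
proof -
  let ?S = "{xs \<in> tuples n T. sum_list (map f xs) \<ge> real T * (\<mu> + y)}"
  have fin: "finite ?S" using finite_tuples[of n T] by (rule rev_finite_subset) auto
  have "real (card ?S) = (\<Sum>xs\<in>?S. 1)" by simp
  \<comment> \<open>Chernoff's method with tilt \<open>y\<close>, the value of \<open>z\<close> that
    minimises the resulting exponent \<open>T * (z^2 / 2 - z * y)\<close>.\<close>
  also have "\<dots> \<le> (\<Sum>xs\<in>?S. exp (y * sum_list (map f xs) - y * (real T * (\<mu> + y))))"
    using assms by (intro sum_mono) (auto intro!: mult_left_mono)
  also have "\<dots> \<le> (\<Sum>xs\<in>tuples n T. exp (y * sum_list (map f xs) - y * (real T * (\<mu> + y))))"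
    by (intro sum_mono2 finite_tuples) auto
  also have "\<dots> = (\<Sum>xs\<in>tuples n T. prod_list (map (\<lambda>x. exp (y * f x)) xs)) * exp (- (y * (real T * (\<mu> + y))))"
    unfolding sum_distrib_right diff_conv_add_uminus exp_add
    by (simp add: sum_list_const_mult[symmetric] exp_sum_list_map)
  also have "\<dots> = (\<Sum>x=1..n. exp (y * f x)) ^ T * exp (- (y * (real T * (\<mu> + y))))"
    by (simp add: sum_prod_list_tuples)
  also have "\<dots> \<le> (real n * exp (y * \<mu> + y\<^sup>2 / 2)) ^ T * exp (- (y * (real T * (\<mu> + y))))"
    using sum_exp_le[OF n f mean \<open>y > 0\<close>] by (intro mult_right_mono power_mono sum_nonneg) auto
  also have "\<dots> = real n ^ T * exp (real T * (y * \<mu> + y\<^sup>2 / 2) - y * (real T * (\<mu> + y)))"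
    by (simp only: power_mult_distrib exp_of_nat_mult[symmetric] mult.assoc mult_exp_exp diff_conv_add_uminus)
  also have "real T * (y * \<mu> + y\<^sup>2 / 2) - y * (real T * (\<mu> + y)) = - real T * y\<^sup>2 / 2"
    by (simp add: algebra_simps power2_eq_square)
  finally show ?thesis .
qed

subsection \<open>Hash functions with prescribed preimage sizes\<close>

text \<open>Only the restriction to \<open>{1..K}\<close> is prescribed. The remaining values stay
  free, so that a pair not contained in \<open>{1..K}\<close> collides with frequency exactly
  \<open>1 / M\<close>.\<close>

definition profile_family :: "nat \<Rightarrow> nat \<Rightarrow> nat \<Rightarrow> (nat \<Rightarrow> nat) \<Rightarrow> (nat \<Rightarrow> nat) set" where
  "profile_family N M K n =
     {h \<in> {1..N} \<rightarrow>\<^sub>E {1..M}. \<forall>j\<in>{1..M}. card {x \<in> {1..K}. h x = j} = n j}"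

lemma finite_profile_family: "finite (profile_family N M K n)"
  by (simp add: profile_family_def finite_PiE)

lemma profile_family_range: "h \<in> profile_family N M K n \<Longrightarrow> x \<in> {1..N} \<Longrightarrow> h x \<in> {1..M}"
  by (auto simp: profile_family_def)

lemma profile_family_card:
  "h \<in> profile_family N M K n \<Longrightarrow> j \<in> {1..M} \<Longrightarrow> card {x \<in> {1..K}. h x = j} = n j"
  by (auto simp: profile_family_def)

text \<open>Induction on \<open>M\<close>: the new symbol is assigned to \<open>n (Suc M)\<close>
  further consecutive points.\<close>

lemma ex_profile:
  "\<exists>g. (\<forall>x\<in>{1..\<Sum>j=1..M. n j}. g x \<in> {1..M}) \<and>
       (\<forall>j\<in>{1..M}. card {x \<in> {1..\<Sum>j=1..M. n j}. g x = j} = n j)" for n :: "nat \<Rightarrow> nat"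
proof (induction M)
  case (Suc M)
  define s where "s = (\<Sum>j=1..M. n j)"
  from Suc obtain g where g: "\<And>x. x \<in> {1..s} \<Longrightarrow> g x \<in> {1..M}"
    "\<And>j. j \<in> {1..M} \<Longrightarrow> card {x \<in> {1..s}. g x = j} = n j"
    unfolding s_def by blast
  define g' where "g' = (\<lambda>x. if x \<le> s then g x else Suc M)"
  have "{x \<in> {1..s + n (Suc M)}. g' x = j} = {x \<in> {1..s}. g x = j}" if "j \<in> {1..M}" for j
    using that by (auto simp: g'_def)
  moreover have "g x \<noteq> Suc M" if "x \<in> {1..s}" for x using g(1)[OF that] by simp
  then have "{x \<in> {1..s + n (Suc M)}. g' x = Suc M} = {s<..s + n (Suc M)}"
    by (fastforce simp: g'_def not_le[symmetric])
  ultimately have "card {x \<in> {1..s + n (Suc M)}. g' x = j} = n j" if "j \<in> {1..Suc M}" for j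
    using that g(2) by (cases "j = Suc M") auto
  moreover have "g' x \<in> {1..Suc M}" if "x \<in> {1..s + n (Suc M)}" for x
    using that g(1)[of x] by (auto simp: g'_def)
  moreover have "(\<Sum>j=1..Suc M. n j) = s + n (Suc M)" by (simp add: s_def)
  ultimately show ?case by (intro exI[of _ g']) auto
qed simp

lemma profile_family_nonempty:
  assumes "(\<Sum>j=1..M. n j) = K" "K \<le> N" "M > 0"
  shows "profile_family N M K n \<noteq> {}"
proof -
  from ex_profile[where M = M and n = n] assms(1) obtain g where g: "\<And>x. x \<in> {1..K} \<Longrightarrow> g x \<in> {1..M}"
    "\<And>j. j \<in> {1..M} \<Longrightarrow> card {x \<in> {1..K}. g x = j} = n j" by blast
  define h where "h = (\<lambda>x\<in>{1..N}. if x \<le> K then g x else 1)"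
  have "h \<in> {1..N} \<rightarrow>\<^sub>E {1..M}" using g(1) assms by (auto simp: h_def)
  moreover have "{x \<in> {1..K}. h x = j} = {x \<in> {1..K}. g x = j}" for j
    using assms by (auto simp: h_def)
  ultimately have "h \<in> profile_family N M K n"
    using g(2) by (simp add: profile_family_def)
  then show ?thesis by auto
qed

text \<open>The profile does not constrain \<open>h x\<close>. Overwriting it by each of the
  \<open>M\<close> symbols therefore maps pairs of a colliding function and a symbol bijectively
  onto the family; the inverse records \<open>h x\<close> and replaces it by
  \<open>h y\<close>.\<close>

lemma card_collision_outside:
  assumes "x \<in> {1..N}" "x > K" "y \<noteq> x" "y \<in> {1..N}"
  shows "M * card {h \<in> profile_family N M K n. h x = h y} = card (profile_family N M K n)"
proof -
  let ?F = "profile_family N M K n"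
  have upd: "h(x := v) \<in> ?F" if "h \<in> ?F" "v \<in> {1..M}" for h v
  proof -
    have "{z \<in> {1..K}. (h(x := v)) z = j} = {z \<in> {1..K}. h z = j}" for j
      using assms by auto
    then show ?thesis using that assms by (auto simp: profile_family_def PiE_iff extensional_def)
  qed
  have "bij_betw (\<lambda>(h, v). h(x := v)) ({h \<in> ?F. h x = h y} \<times> {1..M}) ?F"
    using assms upd profile_family_range[of _ N M K n]
    by (intro bij_betw_byWitness[where f' = "\<lambda>h. (h(x := h y), h x)"]) (auto simp: fun_eq_iff)
  from bij_betw_same_card[OF this] show ?thesis by (simp add: card_cartesian_product mult.commute)
qed

lemma profile_family_transpose:
  assumes "h \<in> profile_family N M K n" "u \<in> {1..K}" "v \<in> {1..K}" "K \<le> N"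
  shows "h \<circ> Transposition.transpose u v \<in> profile_family N M K n"
proof -
  let ?\<sigma> = "Transposition.transpose u v"
  have K: "?\<sigma> x \<in> {1..K} \<longleftrightarrow> x \<in> {1..K}" for x
    using assms by (auto simp: Transposition.transpose_def)
  have N: "?\<sigma> x \<in> {1..N} \<longleftrightarrow> x \<in> {1..N}" for x
    using assms by (auto simp: Transposition.transpose_def)
  have h: "h \<in> {1..N} \<rightarrow>\<^sub>E {1..M}" using assms(1) by (simp add: profile_family_def)
  have "h \<circ> ?\<sigma> \<in> {1..N} \<rightarrow>\<^sub>E {1..M}"
  proof (rule PiE_I)
    show "(h \<circ> ?\<sigma>) x \<in> {1..M}" if "x \<in> {1..N}" for x
      using PiE_mem[OF h, of "?\<sigma> x"] N[of x] that by simp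
    show "(h \<circ> ?\<sigma>) x = undefined" if "x \<notin> {1..N}" for x
      using PiE_arb[OF h, of "?\<sigma> x"] N[of x] that by (metis comp_apply)
  qed
  moreover have "card {x \<in> {1..K}. (h \<circ> ?\<sigma>) x = j} = card {x \<in> {1..K}. h x = j}" for j
    using K by (intro bij_betw_same_card[of ?\<sigma>] bij_betw_byWitness[where f' = ?\<sigma>])
      (auto simp: image_subset_iff simp del: atLeastAtMost_iff)
  ultimately show ?thesis using assms(1) by (auto simp: profile_family_def)
qed

text \<open>Composing with the transposition of \<open>x\<close> and \<open>x'\<close> is an
  involution of the family, and it leaves \<open>h y\<close> unchanged as \<open>y\<close> differs
  from both.\<close>

lemma card_collision_transpose:
  assumes "x \<in> {1..K}" "x' \<in> {1..K}" "y \<noteq> x" "y \<noteq> x'" "K \<le> N"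
  shows "card {h \<in> profile_family N M K n. h x = h y} = card {h \<in> profile_family N M K n. h x' = h y}"
  using assms profile_family_transpose[of _ N M K n x x']
  by (intro bij_betw_same_card[of "\<lambda>h. h \<circ> Transposition.transpose x x'"]
      bij_betw_byWitness[where f' = "\<lambda>h. h \<circ> Transposition.transpose x x'"]) (auto simp: comp_assoc)

text \<open>
  A family closed under permuting \<open>{1..K}\<close> has the same collision probability at all pairs of
  distinct points, so 2-universality there reduces to counting the collisions of one function.
\<close>

lemma card_collision_const:
  assumes "x \<in> {1..K}" "y \<in> {1..K}" "x \<noteq> y" "x' \<in> {1..K}" "y' \<in> {1..K}" "x' \<noteq> y'" "K \<le> N"
  shows "card {h \<in> profile_family N M K n. h x = h y} = card {h \<in> profile_family N M K n. h x' = h y'}"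
proof -
  define c where "c = (\<lambda>x y. card {h \<in> profile_family N M K n. h x = h y})"
  have comm: "c u v = c v u" for u v by (simp add: c_def eq_commute)
  have shift: "c u w = c v w" if "u \<in> {1..K}" "v \<in> {1..K}" "w \<noteq> u" "w \<noteq> v" for u v w
    using card_collision_transpose[OF that assms(7)] by (simp add: c_def)
  have "c x y = c x' y'"
  \<comment> \<open>The endpoints move one at a time and every intermediate pair must be distinct.
    The route from \<open>(x, y)\<close> through \<open>(x', y)\<close> to \<open>(x', y')\<close>
    breaks down only if \<open>x' = y\<close>, and then the pairs share a point and one move
    suffices.\<close>
  proof (cases "x' = y")
    case True
    then show ?thesis using shift[of x y' x'] comm assms by metis
  next
    case False
    then show ?thesis using shift[of x x' y] shift[of y y' x'] comm assms by metis
  qed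
  then show ?thesis by (simp add: c_def)
qed

lemma card_filter_sum: "finite A \<Longrightarrow> card {x \<in> A. P x} = (\<Sum>x\<in>A. if P x then 1 else 0)"
  by (simp add: sum.inter_filter[symmetric])

text \<open>Ordered colliding pairs, grouped by their common value.\<close>

lemma sum_collisions:
  assumes h: "h \<in> profile_family N M K n" and "K \<le> N"
  shows "(\<Sum>u=1..K. card {v \<in> {1..K} - {u}. h u = h v}) = (\<Sum>j=1..M. n j * (n j - 1))"
proof -
  have "card {v \<in> {1..K} - {u}. h u = h v} = n (h u) - 1" if "u \<in> {1..K}" for u
  proof -
    have "{v \<in> {1..K} - {u}. h u = h v} = {v \<in> {1..K}. h v = h u} - {u}" by auto
    then show ?thesis
      using profile_family_card[OF h profile_family_range[OF h, of u]] that \<open>K \<le> N\<close> by auto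
  qed
  then have "(\<Sum>u=1..K. card {v \<in> {1..K} - {u}. h u = h v}) = (\<Sum>u=1..K. n (h u) - 1)" by simp
  also have "\<dots> = (\<Sum>j=1..M. of_nat (card {x \<in> {1..K}. h x = j}) * (n j - 1))"
    using profile_family_range[OF h] \<open>K \<le> N\<close> by (intro sum_fun_comp[where g = h]) auto
  also have "\<dots> = (\<Sum>j=1..M. n j * (n j - 1))"
    using profile_family_card[OF h] by (intro sum.cong) auto
  finally show ?thesis .
qed

text \<open>Double counting of triples \<open>(h, u, v)\<close> with \<open>h u = h v\<close>: each
  of the \<open>K * (K - 1)\<close> ordered pairs collides under equally many functions, and each
  function has the same number of collisions.\<close>

lemma card_collision_inside:
  assumes "x \<in> {1..K}" "y \<in> {1..K}" "x \<noteq> y" "K \<le> N"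
  shows "K * (K - 1) * card {h \<in> profile_family N M K n. h x = h y} =
    card (profile_family N M K n) * (\<Sum>j=1..M. n j * (n j - 1))"
proof -
  let ?F = "profile_family N M K n"
  have "K * (K - 1) * card {h \<in> ?F. h x = h y} =
      (\<Sum>u=1..K. \<Sum>v\<in>{1..K} - {u}. card {h \<in> ?F. h x = h y})"
    by simp
  also have "\<dots> = (\<Sum>u=1..K. \<Sum>v\<in>{1..K} - {u}. card {h \<in> ?F. h u = h v})"
    using assms by (intro sum.cong refl card_collision_const) auto
  also have "\<dots> = (\<Sum>u=1..K. \<Sum>v\<in>{1..K} - {u}. \<Sum>h\<in>?F. if h u = h v then 1 else 0)"
    by (simp add: card_filter_sum finite_profile_family)
  also have "\<dots> = (\<Sum>h\<in>?F. \<Sum>u=1..K. \<Sum>v\<in>{1..K} - {u}. if h u = h v then 1 else 0)"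
    by (simp only: sum.swap[of _ ?F])
  also have "\<dots> = (\<Sum>h\<in>?F. \<Sum>u=1..K. card {v \<in> {1..K} - {u}. h u = h v})"
    by (simp only: card_filter_sum finite_Diff finite_atLeastAtMost)
  also have "\<dots> = card ?F * (\<Sum>j=1..M. n j * (n j - 1))"
    using sum_collisions assms(4) by simp
  finally show ?thesis .
qed

text \<open>A member is uniform in \<^term>\<open>B\<close> with probability \<open>1 / m\<close>, and uniform in \<^term>\<open>G\<close> otherwise.\<close>

definition mixture :: "nat \<Rightarrow> 'a set \<Rightarrow> 'a set \<Rightarrow> 'a multiset" where
  "mixture m B G = repeat_mset (card G) (mset_set B) + repeat_mset ((m - 1) * card B) (mset_set G)"

lemma size_mixture: 
  assumes "m > 0"
  shows "size (mixture m B G) = m * card B * card G"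
  using assms by (cases m) (auto simp: mixture_def algebra_simps)

lemma filter_repeat_mset: "filter_mset P (repeat_mset k A) = repeat_mset k (filter_mset P A)"
  by (rule multiset_eqI) simp

lemma size_filter_mixture:
  assumes "finite B" "finite G"
  shows "size (filter_mset P (mixture m B G)) =
    card G * card {h \<in> B. P h} + (m - 1) * card B * card {h \<in> G. P h}"
  using assms by (simp add: mixture_def filter_repeat_mset filter_mset_mset_set)

lemma set_mixture_subset:
  assumes "finite B" "finite G"
  shows "set_mset (mixture m B G) \<subseteq> B \<union> G"
proof (rule subsetI, rule ccontr)
  fix h assume "h \<in># mixture m B G" "h \<notin> B \<union> G"
  then have "count (mixture m B G) h = 0" by (simp add: mixture_def)
  with \<open>h \<in># mixture m B G\<close> show False by (simp add: count_eq_zero_iff)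
qed

text \<open>The hypothesis \<open>coll\<close> is the bound on the collision frequency averaged over
  the mixture, with denominators cleared. It settles the pairs inside \<open>{1..K}\<close>; all
  other pairs collide with frequency exactly \<open>1 / M\<close> in both components.\<close>

lemma two_universal_mixture:
  fixes N M K m :: nat and n n' :: "nat \<Rightarrow> nat"
  defines "B \<equiv> profile_family N M K n" and "G \<equiv> profile_family N M K n'"
  assumes sums: "(\<Sum>j=1..M. n j) = K" "(\<Sum>j=1..M. n' j) = K"
    and "K \<le> N" "M > 0" "m > 0"
    and coll: "M * ((\<Sum>j=1..M. n j * (n j - 1)) + (m - 1) * (\<Sum>j=1..M. n' j * (n' j - 1)))
      \<le> m * (K * (K - 1))"
  shows "two_universal N M (mixture m B G)"
proof -
  have fin: "finite B" "finite G" by (simp_all add: B_def G_def finite_profile_family)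
  have ne: "B \<noteq> {}" "G \<noteq> {}"
    unfolding B_def G_def using sums \<open>K \<le> N\<close> \<open>M > 0\<close> by (simp_all add: profile_family_nonempty)
  then have pos: "card B > 0" "card G > 0" using fin by (auto simp: card_gt_0_iff)
  let ?H = "mixture m B G"
  have ne': "?H \<noteq> {#}"
    using size_mixture[OF \<open>m > 0\<close>, of B G] pos \<open>m > 0\<close> by (auto simp del: size_eq_0_iff_empty)
  have "B \<union> G \<subseteq> {1..N} \<rightarrow>\<^sub>E {1..M}"
    unfolding B_def G_def profile_family_def by (intro Un_least Collect_restrict)
  then have sub: "set_mset ?H \<subseteq> {1..N} \<rightarrow>\<^sub>E {1..M}"
    using set_mixture_subset[OF fin] by blast
  have "measure_pmf.prob (pmf_of_multiset ?H) {h. h x = h y} \<le> 1 / real M"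
    if xy: "x \<in> {1..N}" "y \<in> {1..N}" "x \<noteq> y" for x y
  proof -
    define b where "b = card {h \<in> B. h x = h y}"
    define g where "g = card {h \<in> G. h x = h y}"
    have "M * (card G * b + (m - 1) * card B * g) \<le> m * card B * card G"
    proof (cases "x \<le> K \<and> y \<le> K")
      case True
      let ?c = "\<Sum>j=1..M. n j * (n j - 1)" and ?c' = "\<Sum>j=1..M. n' j * (n' j - 1)"
      have b: "K * (K - 1) * b = card B * ?c" and g: "K * (K - 1) * g = card G * ?c'"
        unfolding b_def g_def B_def G_def using xy True \<open>K \<le> N\<close>
        by (intro card_collision_inside; simp)+
      have "K * (K - 1) * (M * (card G * b + (m - 1) * card B * g)) =
          M * (card G * (K * (K - 1) * b) + (m - 1) * card B * (K * (K - 1) * g))"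
        by (simp only: add_mult_distrib2 mult_ac)
      also have "\<dots> = card B * card G * (M * (?c + (m - 1) * ?c'))"
        unfolding b g by (simp add: algebra_simps)
      also have "\<dots> \<le> card B * card G * (m * (K * (K - 1)))"
        using coll by (intro mult_left_mono) auto
      finally have "K * (K - 1) * (M * (card G * b + (m - 1) * card B * g)) \<le>
          K * (K - 1) * (m * card B * card G)" by (simp add: algebra_simps)
      moreover have "K * (K - 1) > 0" using True xy by auto
      ultimately show ?thesis by (meson mult_le_cancel1)
    next
      case False
      have eq: "M * card {h \<in> profile_family N M K f. h x = h y} = card (profile_family N M K f)" for f
        using False xy card_collision_outside[of x N K y M f] card_collision_outside[of y N K x M f]
        by (auto simp: eq_commute[of "_ x" "_ y"])
      have b: "M * b = card B" and g: "M * g = card G"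
        unfolding b_def g_def B_def G_def by (rule eq)+
      have "M * (card G * b + (m - 1) * card B * g) = card G * (M * b) + (m - 1) * card B * (M * g)"
        by (simp add: algebra_simps)
      also have "\<dots> = m * card B * card G"
        unfolding b g using \<open>m > 0\<close> by (cases m) (auto simp: algebra_simps)
      finally show ?thesis by simp
    qed
    then have "real M * real (card G * b + (m - 1) * card B * g) \<le> real (m * card B * card G)"
      by (metis of_nat_le_iff of_nat_mult)
    moreover have "size (filter_mset (\<lambda>h. h \<in> {h. h x = h y}) ?H) = card G * b + (m - 1) * card B * g"
      using size_filter_mixture[OF fin, of "\<lambda>h. h x = h y"] by (simp add: b_def g_def)
    moreover have "real (m * card B * card G) > 0" using pos \<open>m > 0\<close> by simp
    ultimately show ?thesis
      using \<open>M > 0\<close> by (simp add: measure_pmf_of_multiset[OF ne'] size_mixture[OF \<open>m > 0\<close>] field_simps)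
  qed
  then show ?thesis using ne' sub by (auto simp: two_universal_def hash_family_def)
qed

subsection \<open>Distinguishing biased functions\<close>

lemma prob_hashed_ge:
  assumes "A \<noteq> {#}" "K > 0"
    and hit: "\<And>h. h \<in> B \<Longrightarrow> real (card {xs \<in> tuples K T. map h xs \<in> S}) \<ge> q * real K ^ T"
  shows "measure_pmf.prob (hashed A (pmf_of_set (tuples K T))) (members (filter_mset (\<lambda>h. h \<in> B) A) \<times> S)
    \<ge> real (size (filter_mset (\<lambda>h. h \<in> B) A)) / real (size A) * q"
proof -
  let ?F = "filter_mset (\<lambda>h. h \<in> B) A"
  let ?D = "members A \<times> tuples K T"
  have sz: "size A > 0" using assms(1) by (simp add: nonempty_has_size)
  then have mem: "members A \<noteq> {}" using card_members[of A] by force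
  have K: "real K ^ T > 0" using assms by simp
  have "measure_pmf.prob (hashed A (pmf_of_set (tuples K T))) (members ?F \<times> S) =
      measure_pmf.prob (pmf_of_set ?D) ((\<lambda>(H, xs). (H, map (fst H) xs)) -` (members ?F \<times> S))"
    unfolding hashed_def using mem tuples_nonempty[OF assms(2)]
    by (simp add: pair_pmf_of_set finite_members finite_tuples)
  also have "\<dots> = real (card (?D \<inter> (\<lambda>(H, xs). (H, map (fst H) xs)) -` (members ?F \<times> S))) / real (card ?D)"
    using mem tuples_nonempty[OF assms(2)]
    by (intro measure_pmf_of_set) (auto simp: finite_members finite_tuples)
  also have "?D \<inter> (\<lambda>(H, xs). (H, map (fst H) xs)) -` (members ?F \<times> S) =
      (SIGMA H:members ?F. {xs \<in> tuples K T. map (fst H) xs \<in> S})"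
    by (auto simp: members_filter)
  also have "real (card \<dots>) = (\<Sum>H\<in>members ?F. real (card {xs \<in> tuples K T. map (fst H) xs \<in> S}))"
    by (simp add: card_SigmaI finite_members finite_tuples)
  also have "real (card ?D) = real (size A) * real K ^ T"
    by (simp add: card_cartesian_product card_members card_tuples)
  finally have eq: "measure_pmf.prob (hashed A (pmf_of_set (tuples K T))) (members ?F \<times> S) =
      (\<Sum>H\<in>members ?F. real (card {xs \<in> tuples K T. map (fst H) xs \<in> S})) / (real (size A) * real K ^ T)" .
  have "real (size ?F) * (q * real K ^ T) = (\<Sum>H\<in>members ?F. q * real K ^ T)"
    by (simp add: card_members)
  also have "\<dots> \<le> (\<Sum>H\<in>members ?F. real (card {xs \<in> tuples K T. map (fst H) xs \<in> S}))"
    using hit by (intro sum_mono) (auto simp: members_filter)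
  finally have "real (size ?F) * (q * real K ^ T) / (real (size A) * real K ^ T) \<le>
      measure_pmf.prob (hashed A (pmf_of_set (tuples K T))) (members ?F \<times> S)"
    unfolding eq using sz K by (intro divide_right_mono) auto
  then show ?thesis using assms(2) by simp
qed

text \<open>The distinguishing event asks that the function lie in \<open>B\<close> and the tuple in
  \<open>S\<close>. It has density at most \<open>b * s\<close> among all pairs, so \<open>Q\<close>
  gives it at most the square root in \<open>gap\<close>, while the hashed source gives it at least
  \<open>b * q\<close>.\<close>

lemma stat_dist_hashed_ge:
  assumes "A \<noteq> {#}" "K > 0" "M > 0" "finite S" "b \<ge> 0"
    and hit: "\<And>h. h \<in> B \<Longrightarrow> real (card {xs \<in> tuples K T. map h xs \<in> S}) \<ge> q * real K ^ T"
    and small: "real (card S) \<le> s * real M ^ T"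
    and frac: "real (size (filter_mset (\<lambda>h. h \<in> B) A)) = b * real (size A)"
    and Q: "cp Q \<le> \<alpha> / (real (size A) * real M ^ T)"
    and gap: "\<epsilon> \<le> b * q - sqrt (b * s * \<alpha>)"
  shows "stat_dist (hashed A (pmf_of_set (tuples K T))) Q \<ge> \<epsilon>"
proof -
  let ?E = "members (filter_mset (\<lambda>h. h \<in> B) A) \<times> S"
  have sz: "real (size A) > 0" using assms(1) by (simp add: nonempty_has_size)
  have cp0: "cp Q \<ge> 0" unfolding cp_def by (intro infsum_nonneg) auto
  have "measure_pmf.prob Q ?E \<le> sqrt (real (card ?E) * cp Q)"
    using assms(4) by (intro prob_le_sqrt_card_cp) (simp add: finite_members)
  also have "real (card ?E) = b * real (size A) * real (card S)"
    by (simp add: card_cartesian_product card_members frac)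
  also have "b * real (size A) * real (card S) * cp Q \<le>
      b * real (size A) * (s * real M ^ T) * (\<alpha> / (real (size A) * real M ^ T))"
    using small Q cp0 sz \<open>b \<ge> 0\<close> order_trans[OF of_nat_0_le_iff small]
    by (intro mult_mono) auto
  also have "\<dots> = b * s * \<alpha>" using assms(1,3) by simp
  finally have "measure_pmf.prob Q ?E \<le> sqrt (b * s * \<alpha>)" by simp
  moreover have "b * q \<le> measure_pmf.prob (hashed A (pmf_of_set (tuples K T))) ?E"
    using prob_hashed_ge[where B = B, OF assms(1,2) hit] assms(1) by (simp add: frac)
  ultimately show ?thesis
    using stat_dist_ge[of "hashed A (pmf_of_set (tuples K T))" ?E Q] gap by linarith
qed

section \<open>Biased profiles and their scores\<close>

definition score :: "nat \<Rightarrow> nat \<Rightarrow> real" where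
  "score a j = of_bool (j \<le> a) - of_bool (a < j \<and> j \<le> 2 * a)"

text \<open>The deviation from the balanced profile is \<open>d\<close> times
  \<open>score a\<close>. This reading of the truncated \<open>k - d\<close> presupposes
  \<open>d \<le> k\<close>.\<close>

definition biased_profile :: "nat \<Rightarrow> nat \<Rightarrow> nat \<Rightarrow> nat \<Rightarrow> nat" where
  "biased_profile a k d j = (if j \<le> a then k + d else if j \<le> 2 * a then k - d else k)"

lemma abs_score_le: "\<bar>score a j\<bar> \<le> 1"
  by (simp add: score_def)

lemma real_biased_profile: "d \<le> k \<Longrightarrow> real (biased_profile a k d j) = real k + score a j * real d"
  by (auto simp: biased_profile_def score_def)

lemma score_sums:
  assumes "2 * a \<le> M"
  shows "(\<Sum>j=1..M. score a j) = 0" "(\<Sum>j=1..M. (score a j)\<^sup>2) = 2 * real a"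
proof -
  have 1: "(\<Sum>j=1..M. of_bool (j \<le> a) :: real) = real a"
  proof -
    have "{1..M} \<inter> {j. j \<le> a} = {1..a}" using assms by auto
    then show ?thesis by (simp add: sum_of_bool_eq)
  qed
  have 2: "(\<Sum>j=1..M. of_bool (a < j \<and> j \<le> 2 * a) :: real) = real a"
  proof -
    have "{1..M} \<inter> {j. a < j \<and> j \<le> 2 * a} = {a<..2 * a}" using assms by auto
    then show ?thesis by (simp add: sum_of_bool_eq)
  qed
  show "(\<Sum>j=1..M. score a j) = 0"
    by (simp only: score_def sum_subtractf 1 2)
  have "(score a j)\<^sup>2 = of_bool (j \<le> a) + of_bool (a < j \<and> j \<le> 2 * a)" for j
    by (simp add: score_def)
  then show "(\<Sum>j=1..M. (score a j)\<^sup>2) = 2 * real a"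
    by (simp only: sum.distrib 1 2)
qed

lemma sum_biased_profile:
  assumes "2 * a \<le> M" "d \<le> k"
  shows "(\<Sum>j=1..M. biased_profile a k d j) = M * k"
proof -
  have "real (\<Sum>j=1..M. biased_profile a k d j) = real M * real k + (\<Sum>j=1..M. score a j) * real d"
    by (simp add: real_biased_profile[OF assms(2)] sum.distrib sum_distrib_right)
  then have "real (\<Sum>j=1..M. biased_profile a k d j) = real (M * k)"
    by (simp add: score_sums[OF assms(1), simplified])
  then show ?thesis by (simp only: of_nat_eq_iff)
qed

text \<open>Scores sum to \<open>0\<close>, so the term linear in \<open>d\<close> cancels and the
  bias costs \<open>2 * a * d^2\<close> ordered collisions beyond the balanced count. The additive
  form avoids truncated subtraction.\<close>

lemma biased_profile_collisions:
  assumes "2 * a \<le> M" "d \<le> k"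
  shows "(\<Sum>j=1..M. biased_profile a k d j * (biased_profile a k d j - 1)) + M * k = M * k\<^sup>2 + 2 * a * d\<^sup>2"
proof -
  have "n * (n - 1) + n = n\<^sup>2" for n :: nat
    by (cases n) (auto simp: power2_eq_square)
  then have "(\<Sum>j=1..M. biased_profile a k d j * (biased_profile a k d j - 1)) + M * k =
      (\<Sum>j=1..M. (biased_profile a k d j)\<^sup>2)"
    by (simp add: sum_biased_profile[OF assms, symmetric] sum.distrib[symmetric])
  also have "real \<dots> = (\<Sum>j=1..M. (real k)\<^sup>2 + 2 * real k * real d * score a j + (real d)\<^sup>2 * (score a j)\<^sup>2)"
    by (simp add: real_biased_profile[OF assms(2)] power2_sum power_mult_distrib mult_ac add_ac)
  also have "\<dots> = real (M * k\<^sup>2 + 2 * a * d\<^sup>2)"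
    by (simp add: sum.distrib sum_distrib_left[symmetric] score_sums[OF assms(1), simplified])
  finally show ?thesis by (simp only: of_nat_eq_iff)
qed

text \<open>In the scaled count of \<open>coll\<close>, a balanced function stays
  \<open>M * (M - 1) * k\<close> below the allowance. Taken \<open>m\<close> times, this slack pays
  for the excess \<open>M * 2 * a * d^2\<close> of the biased part, because
  \<open>2 * a \<le> M \<le> 2 * (M - 1)\<close>.\<close>

lemma two_universal_biased_mixture:
  fixes M N k d m a :: nat
  assumes "M \<ge> 2" "2 * a \<le> M" "d \<le> k" "2 * d\<^sup>2 \<le> m * k" "M * k \<le> N" "m > 0"
  shows "two_universal N M
    (mixture m (profile_family N M (M * k) (biased_profile a k d)) (profile_family N M (M * k) (\<lambda>_. k)))"
proof (rule two_universal_mixture)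
  show "(\<Sum>j=1..M. biased_profile a k d j) = M * k" by (rule sum_biased_profile) fact+
  let ?c = "\<Sum>j=1..M. biased_profile a k d j * (biased_profile a k d j - 1)"
  let ?K = "M * k"
  show "M * (?c + (m - 1) * (\<Sum>j=1..M. k * (k - 1))) \<le> m * (?K * (?K - 1))"
  \<comment> \<open>Once \<open>k > 0\<close>, neither \<open>k - 1\<close> nor
    \<open>M * k - 1\<close> is truncated, and the computation can move to the reals.\<close>
  proof (cases "k = 0")
    case True
    then show ?thesis using assms by (simp add: biased_profile_def)
  next
    case False
    have "?K > 0" using False assms by simp
    have c: "real ?c = real M * (real k)\<^sup>2 + 2 * real a * (real d)\<^sup>2 - real M * real k"
      using arg_cong[OF biased_profile_collisions[OF assms(2,3)], of real] by (simp add: algebra_simps)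
    have "2 * real a * (real d)\<^sup>2 \<le> real M * (real d)\<^sup>2"
      using assms by (intro mult_right_mono) simp_all
    also have "\<dots> \<le> (2 * (real M - 1)) * (real d)\<^sup>2"
      using assms by (intro mult_right_mono) simp_all
    also have "\<dots> = (real M - 1) * real (2 * d\<^sup>2)" by simp
    also have "\<dots> \<le> (real M - 1) * real (m * k)"
      using assms by (intro mult_left_mono of_nat_mono) auto
    finally have "real M * (2 * real a * (real d)\<^sup>2) \<le> real M * ((real M - 1) * (real m * real k))"
      by (intro mult_left_mono) auto
    then have "real M * (real ?c + (real m - 1) * (real M * (real k * (real k - 1)))) \<le>
        real m * (real ?K * (real ?K - 1))"
      unfolding c by (simp add: algebra_simps power2_eq_square)
    also have "real M * (real ?c + (real m - 1) * (real M * (real k * (real k - 1)))) =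
        real (M * (?c + (m - 1) * (\<Sum>j=1..M. k * (k - 1))))"
      using False \<open>m > 0\<close> by (simp add: of_nat_diff)
    also have "real m * (real ?K * (real ?K - 1)) = real (m * (?K * (?K - 1)))"
      using of_nat_diff[of 1 ?K, where 'a = real] \<open>?K > 0\<close> by (simp only: of_nat_mult) simp
    finally show ?thesis by (simp only: of_nat_le_iff)
  qed
qed (use assms in simp_all)

text \<open>No function is both biased and balanced: symbol \<open>1\<close> has
  \<open>k + d\<close> preimages in one case and \<open>k\<close> in the other.\<close>

lemma biased_fraction:
  assumes "M > 0" "0 < a" "0 < d" "m > 0" "2 * a \<le> M" "d \<le> k" "M * k \<le> N"
  defines "B \<equiv> profile_family N M (M * k) (biased_profile a k d)"
  shows "real (size (filter_mset (\<lambda>h. h \<in> B) (mixture m B (profile_family N M (M * k) (\<lambda>_. k))))) =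
    1 / real m * real (size (mixture m B (profile_family N M (M * k) (\<lambda>_. k))))"
proof -
  let ?G = "profile_family N M (M * k) (\<lambda>_. k)"
  have 1: "1 \<in> {1..M}" using assms by simp
  have "h \<notin> ?G" if "h \<in> B" for h
    using profile_family_card[OF that[unfolded B_def] 1] profile_family_card[of h N M "M * k" "\<lambda>_. k", OF _ 1] assms
    by (auto simp: biased_profile_def)
  then have "{h \<in> ?G. h \<in> B} = {}" by auto
  then show ?thesis
    using \<open>m > 0\<close> by (simp add: size_mixture size_filter_mixture finite_profile_family B_def)
qed

text \<open>For \<open>d = k\<close> the symbols in \<open>{a<..2 * a}\<close> have no preimage at
  all.\<close>

lemma biased_avoids:
  assumes "h \<in> profile_family N M (M * k) (biased_profile a k k)" "2 * a \<le> M" "M * k \<le> N"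
    "xs \<in> tuples (M * k) T"
  shows "map h xs \<in> {ys. set ys \<subseteq> {1..M} - {a<..2 * a} \<and> length ys = T}"
proof -
  have "h x \<in> {1..M} - {a<..2 * a}" if x: "x \<in> {1..M * k}" for x
  proof -
    have r: "h x \<in> {1..M}" using profile_family_range[OF assms(1), of x] x assms(3) by auto
    have "card {y \<in> {1..M * k}. h y = h x} \<noteq> 0" using x by auto
    then have "biased_profile a k k (h x) \<noteq> 0"
      using profile_family_card[OF assms(1) r] by metis
    then show ?thesis using r by (auto simp: biased_profile_def split: if_splits)
  qed
  then show ?thesis using assms(4) by (auto simp: tuples_def subset_iff)
qed

text \<open>Weighted by the profile, the constant part \<open>k\<close> cancels and the bias leaves
  \<open>d\<close> times the second moment of the score.\<close>

lemma sum_score_biased: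
  assumes "h \<in> profile_family N M (M * k) (biased_profile a k d)" "2 * a \<le> M" "M * k \<le> N" "d \<le> k"
  shows "(\<Sum>x=1..M * k. score a (h x)) = 2 * real a * real d"
proof -
  have "(\<Sum>x=1..M * k. score a (h x)) = (\<Sum>j=1..M. real (card {x \<in> {1..M * k}. h x = j}) * score a j)"
    using profile_family_range[OF assms(1)] assms(3) by (intro sum_fun_comp) auto
  also have "\<dots> = (\<Sum>j=1..M. real k * score a j + real d * (score a j)\<^sup>2)"
    using profile_family_card[OF assms(1)]
    by (intro sum.cong) (auto simp: real_biased_profile[OF assms(4)] algebra_simps power2_eq_square)
  also have "\<dots> = 2 * real a * real d"
    by (simp add: sum.distrib sum_distrib_left[symmetric] score_sums[OF assms(2), simplified])
  finally show ?thesis .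
qed

text \<open>A hashed block has mean score \<open>2 * \<theta>\<close>, so missing the threshold is a
  deviation by \<theta> below the mean. The upper tail bound is applied to the negated
  score.\<close>

lemma biased_hits:
  assumes h: "h \<in> profile_family N M (M * k) (biased_profile a k d)"
    and "M > 0" "k > 0" "0 < a" "0 < d" "2 * a \<le> M" "M * k \<le> N" "d \<le> k" "T > 0"
    and \<theta>: "\<theta> = real a * real d / real (M * k)"
  shows "real (card {xs \<in> tuples (M * k) T. map h xs \<in> {ys \<in> tuples M T. sum_list (map (score a) ys) \<ge> real T * \<theta>}})
    \<ge> (1 - exp (- real T * \<theta>\<^sup>2 / 2)) * real (M * k) ^ T"
proof -
  let ?K = "M * k"
  let ?X = "tuples ?K T"
  let ?S = "{ys \<in> tuples M T. sum_list (map (score a) ys) \<ge> real T * \<theta>}"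
  have K: "?K > 0" and "\<theta> > 0" using assms by auto
  let ?f = "\<lambda>x. - score a (h x)"
  let ?Bad = "{xs \<in> ?X. sum_list (map ?f xs) \<ge> real T * (- (2 * \<theta>) + \<theta>)}"
  have "?X \<subseteq> {xs \<in> ?X. map h xs \<in> ?S} \<union> ?Bad"
  proof
    fix xs assume xs: "xs \<in> ?X"
    have "h x \<in> {1..M}" if "x \<in> set xs" for x
      using that xs assms(7) by (intro profile_family_range[OF h]) (auto simp: tuples_def subset_iff)
    then have "map h xs \<in> tuples M T"
      using xs by (auto simp: tuples_def)
    moreover have "sum_list (map ?f xs) = - sum_list (map (score a) (map h xs))"
      by (simp add: uminus_sum_list_map o_def)
    ultimately show "xs \<in> {xs \<in> ?X. map h xs \<in> ?S} \<union> ?Bad"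
      using xs by auto
  qed
  then have "card ?X \<le> card ({xs \<in> ?X. map h xs \<in> ?S} \<union> ?Bad)"
    by (intro card_mono) (simp_all add: finite_tuples)
  also have "\<dots> \<le> card {xs \<in> ?X. map h xs \<in> ?S} + card ?Bad" by (rule card_Un_le)
  finally have cX: "card ?X \<le> card {xs \<in> ?X. map h xs \<in> ?S} + card ?Bad" .
  have "real (card ?Bad) \<le> real ?K ^ T * exp (- real T * \<theta>\<^sup>2 / 2)"
    using K \<open>\<theta> > 0\<close> \<open>T > 0\<close> abs_score_le sum_score_biased[OF h assms(6,7,8)]
    by (intro card_tuples_sum_ge) (auto simp: sum_negf \<theta>)
  moreover have "real ?K ^ T \<le> real (card {xs \<in> ?X. map h xs \<in> ?S}) + real (card ?Bad)"
    using cX by (simp only: card_tuples of_nat_add[symmetric] of_nat_power[symmetric] of_nat_le_iff)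
  ultimately show ?thesis by (simp add: algebra_simps)
qed

lemma card_high_score_le:
  assumes "M > 0" "2 * a \<le> M" "T > 0" "\<theta> > 0"
  shows "real (card {ys \<in> tuples M T. sum_list (map (score a) ys) \<ge> real T * \<theta>})
    \<le> exp (- real T * \<theta>\<^sup>2 / 2) * real M ^ T"
  using card_tuples_sum_ge[of M "score a" 0 T \<theta>] assms abs_score_le score_sums[OF assms(2)]
  by (simp add: mult.commute)

section \<open>Far families for weak and strong collision budgets\<close>

text \<open>The bias \<open>d\<close> and the test set \<open>S\<close> are left open, since the two
  regimes of \<open>m\<close> against \<open>k\<close> call for different tests.\<close>

lemma ex_far_family:
  fixes M N T m k d a :: nat and \<epsilon> \<alpha> q s :: real
  assumes M: "M \<ge> 2" and a: "0 < a" "2 * a \<le> M" and d: "0 < d" "d \<le> k" "2 * d\<^sup>2 \<le> m * k"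
    and "M * k \<le> N" "m > 0" "finite S"
    and hit: "\<And>h. h \<in> profile_family N M (M * k) (biased_profile a k d) \<Longrightarrow>
      real (card {xs \<in> tuples (M * k) T. map h xs \<in> S}) \<ge> q * real (M * k) ^ T"
    and small: "real (card S) \<le> s * real M ^ T"
    and gap: "\<epsilon> \<le> 1 / real m * q - sqrt (1 / real m * s * \<alpha>)"
  shows "\<exists>\<H>. two_universal N M \<H> \<and>
    (\<forall>Q. cp Q \<le> \<alpha> / (real (size \<H>) * real M ^ T) \<longrightarrow>
       stat_dist (hashed \<H> (pmf_of_set (tuples (M * k) T))) Q \<ge> \<epsilon>)"
proof (intro exI conjI allI impI)
  let ?B = "profile_family N M (M * k) (biased_profile a k d)"
  let ?G = "profile_family N M (M * k) (\<lambda>_. k)"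
  let ?H = "mixture m ?B ?G"
  show 2: "two_universal N M ?H"
    by (intro two_universal_biased_mixture) fact+
  then have ne: "?H \<noteq> {#}" by (simp add: two_universal_def hash_family_def)
  fix Q :: "(((nat \<Rightarrow> nat) \<times> nat) \<times> nat list) pmf"
  assume "cp Q \<le> \<alpha> / (real (size ?H) * real M ^ T)"
  then show "stat_dist (hashed ?H (pmf_of_set (tuples (M * k) T))) Q \<ge> \<epsilon>"
    using M d a assms(7-9) hit small gap ne biased_fraction[of M a d m k N]
    by (intro stat_dist_hashed_ge[where B = ?B and b = "1 / real m" and S = S and q = q and s = s and \<alpha> = \<alpha>])
      auto
qed

text \<open>Biased functions avoid \<^term>\<open>a\<close> of the \<^term>\<open>M\<close> symbols altogether, so their tuples lie in an exponentially small set.\<close>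

lemma ex_far_family_small:
  fixes M N T m k :: nat and \<epsilon> \<alpha> :: real
  assumes M: "M \<ge> 2" and \<epsilon>: "0 < \<epsilon>" "\<epsilon> < 1/4" and \<alpha>: "\<alpha> \<ge> 1"
    and T: "real T \<ge> real M * log 2 (\<alpha> / \<epsilon>)"
    and m: "2 * \<epsilon> \<le> 1 / real m" "m > 0" and k: "0 < k" "2 * k \<le> m" "M * k \<le> N"
  shows "\<exists>\<H>. two_universal N M \<H> \<and>
    (\<forall>Q. cp Q \<le> \<alpha> / (real (size \<H>) * real M ^ T) \<longrightarrow>
       stat_dist (hashed \<H> (pmf_of_set (tuples (M * k) T))) Q \<ge> \<epsilon>)"
proof -
  define a where "a = M div 2"
  \<comment> \<open>The extreme case of \<open>M \<le> 3 * a\<close> is \<open>M = 3\<close>; it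
    gives \<open>r \<le> 2/3\<close> below.\<close>
  have a: "0 < a" "2 * a \<le> M" "M \<le> 3 * a" using M by (auto simp: a_def)
  define r where "r = real (M - a) / real M"
  define L where "L = log 2 (\<alpha> / \<epsilon>)"
  have r: "0 < r" "r \<le> 2/3"
    using a M by (auto simp: r_def field_simps of_nat_diff)
  have "4 * \<epsilon> < \<alpha>" using \<epsilon> \<alpha> by simp
  then have "\<alpha> / \<epsilon> > 4" using \<epsilon> by (simp add: field_simps)
  then have L: "L \<ge> 2" by (simp add: L_def le_log_iff)
  have rM: "r ^ M \<le> 8/27"
  proof (cases "M = 2")
    case True
    then show ?thesis by (simp add: r_def a_def power2_eq_square)
  next
    case False
    then have "r ^ M \<le> r ^ 3" using M r by (intro power_decreasing) auto
    also have "\<dots> \<le> (2/3) ^ 3" using r by (intro power_mono) auto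
    finally show ?thesis by (simp add: power3_eq_cube)
  qed
  have "r ^ T = r powr real T" using r by (simp add: powr_realpow)
  also have "\<dots> \<le> r powr (real M * L)"
    using T r by (intro powr_mono') (auto simp: L_def)
  also have "\<dots> = (r ^ M) powr L" using r by (simp add: powr_powr[symmetric] powr_realpow)
  also have "\<dots> \<le> (8/27) powr L" using rM r L by (intro powr_mono2) auto
  \<comment> \<open>The factor \<open>(1/2) powr L\<close> is exactly
    \<open>\<epsilon> / \<alpha>\<close>. The other factor is at most \<open>1/2\<close> since
    \<open>L \<ge> 2\<close>, a reserve needed for the gap.\<close>
  also have "\<dots> = ((16/27) * (1/2)) powr L" by simp
  also have "\<dots> = (16/27) powr L * (1/2) powr L" by (subst powr_mult) auto
  also have "(16/27 :: real) powr L \<le> (16/27) powr 2" using L by (intro powr_mono') auto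
  also have "(16/27 :: real) powr 2 \<le> 1/2" by (simp add: power2_eq_square)
  also have "(1/2) powr L = inverse (2 powr L)" by (simp add: powr_divide inverse_eq_divide)
  also have "2 powr L = \<alpha> / \<epsilon>" unfolding L_def using \<epsilon> \<alpha> by (subst powr_log_cancel) auto
  finally have rT: "r ^ T * \<alpha> \<le> \<epsilon> / 2"
    using \<epsilon> \<alpha> by (simp add: field_simps mult_right_mono)
  let ?S = "{ys. set ys \<subseteq> {1..M} - {a<..2 * a} \<and> length ys = T}"
  show ?thesis
  proof (rule ex_far_family[where d = k and S = ?S and s = "r ^ T" and q = 1])
    \<comment> \<open>Full depletion \<open>d = k\<close> fits the collision budget because
      \<open>2 * k \<le> m\<close>.\<close>
    show "2 * k\<^sup>2 \<le> m * k" using k by (simp add: power2_eq_square)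
    show "finite ?S" by (rule finite_lists_length_eq) simp
    have "{a<..2 * a} \<subseteq> {1..M}" using a by auto
    then have "card ({1..M} - {a<..2 * a}) = M - a" by (simp add: card_Diff_subset)
    then have "real (card ?S) = real (M - a) ^ T" by (simp add: card_lists_length_eq)
    also have "\<dots> = r ^ T * real M ^ T" using M by (simp add: r_def power_divide)
    finally show "real (card ?S) \<le> r ^ T * real M ^ T" by simp
    \<comment> \<open>With \<open>b = 1 / m\<close> the root is at most \<open>b / 2\<close>, which
      leaves \<open>b / 2 \<ge> \<epsilon>\<close>.\<close>
    have "1 / real m * r ^ T * \<alpha> \<le> 1 / real m * (\<epsilon> / 2)"
      unfolding mult.assoc using rT by (intro mult_left_mono) auto
    also have "\<dots> \<le> 1 / real m * (1 / real m / 4)"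
      using m by (intro mult_left_mono) auto
    also have "\<dots> = (1 / real m / 2)\<^sup>2" by (simp add: power2_eq_square)
    finally have "sqrt (1 / real m * r ^ T * \<alpha>) \<le> 1 / real m / 2"
      by (intro real_le_lsqrt) auto
    moreover have "\<epsilon> \<le> b * 1 - x" if "x \<le> b / 2" "2 * \<epsilon> \<le> b" for x b :: real
      using that by linarith
    ultimately show "\<epsilon> \<le> 1 / real m * 1 - sqrt (1 / real m * r ^ T * \<alpha>)" using m by blast
    fix h assume h: "h \<in> profile_family N M (M * k) (biased_profile a k k)"
    have "{xs \<in> tuples (M * k) T. map h xs \<in> ?S} = tuples (M * k) T"
      using biased_avoids[OF h a(2) k(3)] by blast
    then show "real (card {xs \<in> tuples (M * k) T. map h xs \<in> ?S}) \<ge> 1 * real (M * k) ^ T"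
      by (simp add: card_tuples)
  qed (use M a k m in auto)
qed

text \<open>
  The score of a tuple concentrates around \<open>0\<close> for uniform tuples and around \<open>2 * T * \<theta>\<close> for
  tuples hashed by a biased function; the distinguisher is the threshold test at \<open>T * \<theta>\<close>.
\<close>

lemma ex_far_family_large:
  fixes M N T m k :: nat and \<epsilon> \<alpha> W :: real
  assumes M: "M \<ge> 2" and \<epsilon>: "0 < \<epsilon>" "\<epsilon> < 1/4" and \<alpha>: "\<alpha> \<ge> 1"
    and T: "real T \<ge> \<epsilon> * W * log 2 (\<alpha> / \<epsilon>)"
    and m: "2 * \<epsilon> \<le> 1 / real m" "1 / real m \<le> 3 * \<epsilon>" "m \<ge> 2"
    and k: "0 < k" "m < 2 * k" "M * k \<le> N" "1296 * real k \<le> W"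
  shows "\<exists>\<H>. two_universal N M \<H> \<and>
    (\<forall>Q. cp Q \<le> \<alpha> / (real (size \<H>) * real M ^ T) \<longrightarrow>
       stat_dist (hashed \<H> (pmf_of_set (tuples (M * k) T))) Q \<ge> \<epsilon>)"
proof -
  define a where "a = M div 2"
  have a: "0 < a" "2 * a \<le> M" "M \<le> 3 * a" using M by (auto simp: a_def)
  define L where "L = log 2 (\<alpha> / \<epsilon>)"
  \<comment> \<open>The largest real bias within the budget \<open>2 * d^2 \<le> m * k\<close>. As
    \<open>r \<ge> 1\<close>, rounding down loses at most a factor \<open>2\<close>.\<close>
  define r where "r = sqrt (real (m * k) / 2)"
  define d where "d = nat \<lfloor>r\<rfloor>"
  have "2 * 1 \<le> m * k" using m k by (intro mult_mono) auto
  then have "real (m * k) \<ge> 2" by linarith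
  then have r: "r \<ge> 1" "r\<^sup>2 = real (m * k) / 2" by (auto simp: r_def)
  then have d: "1 \<le> d" "real d \<le> r" "r < real d + 1"
    unfolding d_def by linarith+
  have "(real d)\<^sup>2 \<le> r\<^sup>2" using d by (intro power_mono) auto
  then have "real (2 * d\<^sup>2) \<le> real (m * k)" unfolding r(2) by simp
  then have dk: "2 * d\<^sup>2 \<le> m * k" by (simp only: of_nat_le_iff)
  have "m * k < 2 * k\<^sup>2"
    using mult_strict_right_mono[OF k(2,1)] by (simp add: power2_eq_square)
  then have "d\<^sup>2 < k\<^sup>2" using dk by linarith
  then have "d \<le> k" by (simp add: power2_less_imp_less less_imp_le)
  have "(r / 2)\<^sup>2 \<le> (real d)\<^sup>2" using d r by (intro power_mono) linarith+
  then have d2: "real m * real k / 8 \<le> (real d)\<^sup>2" using r(2) by (simp add: power_divide)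
  \<comment> \<open>Half the mean score of a hashed block; \<open>M \<le> 3 * a\<close> turns it
    into the bound \<open>d / (3 * k)\<close>.\<close>
  define \<theta> where "\<theta> = real a * real d / real (M * k)"
  have "real M \<le> 3 * real a" using a by linarith
  then have "real d * real M \<le> real d * (3 * real a)" by (intro mult_left_mono) auto
  then have "real d * real M / (3 * real M * real k) \<le> \<theta>"
    unfolding \<theta>_def using M k by (simp add: field_simps)
  then have \<theta>: "real d / (3 * real k) \<le> \<theta>" using M by simp
  have "4 * \<epsilon> < \<alpha>" using \<epsilon> \<alpha> by simp
  then have "\<alpha> / \<epsilon> > 4" using \<epsilon> by (simp add: field_simps)
  then have Lpos: "L > 0" by (simp add: L_def)
  have "ln 2 \<le> (1::real)" using ln_le_minus_one[of "2::real"] by simp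
  then have "L * ln 2 \<le> L * 1" using Lpos by (intro mult_left_mono) auto
  then have L: "ln (\<alpha> / \<epsilon>) \<le> L" by (simp add: L_def log_def)
  have W: "W > 0" using k by (intro less_le_trans[OF _ k(4)]) simp
  \<comment> \<open>The constant \<open>1296\<close> is \<open>6 * 3 * 8 * 9\<close>: the losses are
    \<open>3\<close> in \<open>1 / m \<le> 3 * \<epsilon>\<close>, \<open>8\<close> in the bound on
    \<open>d^2\<close> and \<open>9\<close> in the bound on \<theta> squared. The target
    \<open>6 * L\<close> makes \<delta> at most the cube of
    \<open>\<epsilon> / \<alpha>\<close>.\<close>
  have "6 * L = 1 / (3 * real m) * (1296 * real k) * L * (real m * real k / 8 / (9 * (real k)\<^sup>2))"
    using k m by (simp add: power2_eq_square)
  also have "\<dots> \<le> \<epsilon> * W * L * ((real d)\<^sup>2 / (9 * (real k)\<^sup>2))"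
    using m k d2 Lpos \<epsilon> W by (intro mult_mono divide_right_mono) auto
  also have "\<dots> \<le> real T * ((real d)\<^sup>2 / (9 * (real k)\<^sup>2))"
    using T by (intro mult_right_mono) (auto simp: L_def)
  also have "(real d)\<^sup>2 / (9 * (real k)\<^sup>2) = (real d / (3 * real k))\<^sup>2"
    by (simp add: power_divide power_mult_distrib)
  also have "real T * \<dots> \<le> real T * \<theta>\<^sup>2"
    using \<theta> by (intro mult_left_mono power_mono) auto
  finally have T\<theta>: "real T * \<theta>\<^sup>2 \<ge> 6 * L" .
  then have "T > 0" using Lpos by (cases T) auto
  have "\<theta> > 0" using a d M k by (auto simp: \<theta>_def)
  \<comment> \<open>Bounds both the density of \<open>?S\<close> among all tuples and the
    probability that a biased function misses \<open>?S\<close>.\<close>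
  define \<delta> where "\<delta> = exp (- real T * \<theta>\<^sup>2 / 2)"
  have "\<delta> \<le> exp (3 * - ln (\<alpha> / \<epsilon>))" unfolding \<delta>_def using T\<theta> L by simp
  also have "\<dots> = (\<epsilon> / \<alpha>) ^ 3"
    using \<epsilon> \<alpha> exp_of_nat_mult[of 3 "- ln (\<alpha> / \<epsilon>)"] by (simp add: exp_minus)
  finally have \<delta>: "\<delta> \<le> (\<epsilon> / \<alpha>) ^ 3" .
  have "\<epsilon> / \<alpha> \<le> \<epsilon>" using \<epsilon> \<alpha> by (simp add: field_simps)
  then have "(\<epsilon> / \<alpha>) ^ 2 \<le> (1/4) ^ 2" using \<epsilon> \<alpha> by (intro power_mono) auto
  then have "(\<epsilon> / \<alpha>) ^ 2 * \<epsilon> \<le> 1/16 * \<epsilon>"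
    using \<epsilon> by (intro mult_right_mono) (auto simp: power2_eq_square)
  moreover have "\<delta> * \<alpha> \<le> (\<epsilon> / \<alpha>) ^ 3 * \<alpha>" using \<delta> \<alpha> by (intro mult_right_mono) auto
  moreover have "(\<epsilon> / \<alpha>) ^ 3 * \<alpha> = (\<epsilon> / \<alpha>) ^ 2 * \<epsilon>" using \<alpha> by (simp add: power3_eq_cube power2_eq_square)
  ultimately have \<delta>\<alpha>: "\<delta> * \<alpha> \<le> \<epsilon> / 16" by linarith
  have "\<delta> \<ge> 0" by (simp add: \<delta>_def)
  then have "\<delta> * 1 \<le> \<delta> * \<alpha>" using \<alpha> by (intro mult_left_mono) auto
  then have \<delta>4: "\<delta> \<le> 1/4" using \<delta>\<alpha> \<epsilon> by linarith
  let ?S = "{ys \<in> tuples M T. sum_list (map (score a) ys) \<ge> real T * \<theta>}"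
  show ?thesis
  proof (rule ex_far_family[where d = d and S = ?S and s = \<delta> and q = "1 - \<delta>"])
    show "finite ?S" using finite_tuples by simp
    show "real (card ?S) \<le> \<delta> * real M ^ T"
      unfolding \<delta>_def using M a \<open>T > 0\<close> \<open>\<theta> > 0\<close> by (intro card_high_score_le) auto
    \<comment> \<open>With \<open>b = 1 / m\<close> the root is at most \<open>b / 4\<close> and the
      hit probability at least \<open>3 * b / 4\<close>; the difference \<open>b / 2\<close> is at
      least \<epsilon>.\<close>
    have "1 / real m * \<delta> * \<alpha> \<le> 1 / real m * (\<epsilon> / 16)"
      unfolding mult.assoc using \<delta>\<alpha> by (intro mult_left_mono) auto
    also have "\<dots> \<le> 1 / real m * (1 / real m / 16)"
      using m \<epsilon> by (intro mult_left_mono) auto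
    also have "\<dots> = (1 / real m / 4)\<^sup>2" by (simp add: power2_eq_square)
    finally have "sqrt (1 / real m * \<delta> * \<alpha>) \<le> 1 / real m / 4"
      by (intro real_le_lsqrt) auto
    moreover have "1 / real m * (3/4) \<le> 1 / real m * (1 - \<delta>)"
      using \<delta>4 by (intro mult_left_mono) auto
    moreover have "\<epsilon> \<le> y - x" if "x \<le> b / 4" "b * (3/4) \<le> y" "2 * \<epsilon> \<le> b" for x y b :: real
      using that by linarith
    ultimately show "\<epsilon> \<le> 1 / real m * (1 - \<delta>) - sqrt (1 / real m * \<delta> * \<alpha>)" using m(1) by blast
    fix h assume h: "h \<in> profile_family N M (M * k) (biased_profile a k d)"
    show "real (card {xs \<in> tuples (M * k) T. map h xs \<in> ?S}) \<ge> (1 - \<delta>) * real (M * k) ^ T"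
      unfolding \<delta>_def using M a k d \<open>d \<le> k\<close> \<open>T > 0\<close> by (intro biased_hits[OF h]) (auto simp: \<theta>_def)
  qed (use M a k m d dk \<open>d \<le> k\<close> in auto)
qed

section \<open>Choice of the parameters\<close>

lemma nat_floor_inverse_bounds:
  fixes \<epsilon> :: real
  assumes "0 < \<epsilon>" "\<epsilon> < 1/4"
  defines "m \<equiv> nat \<lfloor>1 / (2 * \<epsilon>)\<rfloor>"
  shows "m \<ge> 2" "2 * \<epsilon> \<le> 1 / real m" "1 / real m \<le> 3 * \<epsilon>"
proof -
  have "1 / (2 * \<epsilon>) \<ge> 2" using assms by (simp add: field_simps)
  then show m2: "m \<ge> 2" unfolding m_def by linarith
  have m: "real m \<le> 1 / (2 * \<epsilon>)" "1 / (2 * \<epsilon>) < real m + 1"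
    unfolding m_def using \<open>1 / (2 * \<epsilon>) \<ge> 2\<close> by linarith+
  show "2 * \<epsilon> \<le> 1 / real m" using m(1) m2 assms(1) by (simp add: field_simps)
  \<comment> \<open>Here \<open>m + 1 \<le> 3/2 * m\<close>, as \<open>m \<ge> 2\<close>.\<close>
  have "1 / (2 * \<epsilon>) < 3/2 * real m" using m(2) m2 by linarith
  then show "1 / real m \<le> 3 * \<epsilon>" using m2 assms(1) by (simp add: field_simps)
qed

theorem theorem4p11:
  shows "\<exists>c::real. c > 0 \<and>
    (\<forall>(M::nat) (\<epsilon>::real) (\<alpha>::real) (t::int) (N::nat) (T::nat).
       primepow M \<longrightarrow> 0 < \<epsilon> \<longrightarrow> \<epsilon> < 1/4 \<longrightarrow> \<alpha> \<ge> 1 \<longrightarrow>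
       \<epsilon> * real M powi (t - 1) \<ge> 1 \<longrightarrow>
       real N \<ge> 6 * \<epsilon> * real M powi (2 * t) \<longrightarrow>
       int T = \<lceil>\<epsilon>\<^sup>2 * real M powi (2 * t - 1) * log 2 (\<alpha> / \<epsilon>)\<rceil> \<longrightarrow>
       (\<exists>(K::nat) (\<H>::(nat \<Rightarrow> nat) multiset) (X::nat list pmf).
          real K \<ge> c * real M * real T / (\<epsilon> * log 2 (\<alpha> / \<epsilon>)) \<and>
          two_universal N M \<H> \<and>
          block_source N T K X \<and>
          (\<forall>Q :: (((nat \<Rightarrow> nat) \<times> nat) \<times> nat list) pmf.
             set_pmf Q \<subseteq> members \<H> \<times> tuples M T \<longrightarrow>
             cp Q \<le> \<alpha> / (real (size \<H>) * real M ^ T) \<longrightarrow>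
             stat_dist (hashed \<H> X) Q \<ge> \<epsilon>)))"
proof (intro exI[of _ "1 / 5184 :: real"] conjI allI impI)
  fix M N T :: nat and \<epsilon> \<alpha> :: real and t :: int
  assume "primepow M" and \<epsilon>: "0 < \<epsilon>" "\<epsilon> < 1/4" and \<alpha>: "\<alpha> \<ge> 1"
    and t: "\<epsilon> * real M powi (t - 1) \<ge> 1"
    and N: "real N \<ge> 6 * \<epsilon> * real M powi (2 * t)"
    and T: "int T = \<lceil>\<epsilon>\<^sup>2 * real M powi (2 * t - 1) * log 2 (\<alpha> / \<epsilon>)\<rceil>"
  have M: "M \<ge> 2" using primepow_gt_Suc_0[OF \<open>primepow M\<close>] by simp
  define p where "p = real M powi (t - 1)"
  \<comment> \<open>In terms of \<open>W\<close>, the number of blocks is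
    \<open>\<epsilon> * W * L\<close> rounded up, and the bound on \<open>N\<close> reads
    \<open>6 * W * M\<close>. From \<open>\<epsilon> * p \<ge> 1\<close> it follows that
    \<open>\<epsilon> * W \<ge> M\<close>.\<close>
  define W where "W = \<epsilon> * p * p * real M"
  define L where "L = log 2 (\<alpha> / \<epsilon>)"
  have "real M powi (2 * t - 1) = real M powi ((t - 1) + (t - 1) + 1)" by (simp add: algebra_simps)
  also have "\<dots> = p * p * real M" using M unfolding p_def by (subst power_int_add | simp)+
  finally have pow1: "real M powi (2 * t - 1) = p * p * real M" .
  have "real M powi (2 * t) = real M powi ((2 * t - 1) + 1)" by simp
  also have "\<dots> = p * p * real M * real M" using M by (subst power_int_add) (auto simp: pow1)
  finally have N: "real N \<ge> 6 * W * real M" using N by (simp add: W_def mult_ac)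
  have "1 * 1 \<le> (\<epsilon> * p) * (\<epsilon> * p)" using t by (intro mult_mono) (auto simp: p_def)
  then have "1 * real M \<le> (\<epsilon> * p) * (\<epsilon> * p) * real M" by (intro mult_right_mono) auto
  then have \<epsilon>W: "real M \<le> \<epsilon> * W" by (simp add: W_def mult_ac)
  then have "2 \<le> \<epsilon> * W" using M by linarith
  then have "W > 0" using \<epsilon> by (metis less_le_trans zero_less_numeral zero_less_mult_pos)
  moreover have "\<epsilon> * W \<le> 1 * W" using \<epsilon> \<open>W > 0\<close> by (intro mult_right_mono) auto
  ultimately have W: "W \<ge> 2" using \<open>2 \<le> \<epsilon> * W\<close> by linarith
  have "4 * \<epsilon> < \<alpha>" using \<epsilon> \<alpha> by simp
  then have "\<alpha> / \<epsilon> > 4" using \<epsilon> by (simp add: field_simps)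
  then have L: "L \<ge> 1" by (simp add: L_def le_log_iff)
  have "\<epsilon>\<^sup>2 * real M powi (2 * t - 1) * log 2 (\<alpha> / \<epsilon>) = \<epsilon> * W * L"
    unfolding pow1 by (simp add: W_def L_def power2_eq_square)
  then have "T = nat \<lceil>\<epsilon> * W * L\<rceil>" using T by simp
  moreover have "\<epsilon> * W * L > 0" using \<epsilon> W L by simp
  ultimately have T1: "\<epsilon> * W * L \<le> real T" and T2: "real T \<le> \<epsilon> * W * L + 1"
    by linarith+
  \<comment> \<open>Rounding up at most doubles \<open>k\<close> when \<open>k \<ge> 2\<close>, which yields the bound \<open>1296 * k \<le> W\<close> needed for
    concentration; \<open>k = 1\<close> always falls under \<open>2 * k \<le> m\<close>.\<close>
  define k where "k = nat \<lceil>W / 2592\<rceil>"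
  have k: "W / 2592 \<le> real k" "real k < W / 2592 + 1" "k > 0"
    unfolding k_def using W by linarith+
  define m where "m = nat \<lfloor>1 / (2 * \<epsilon>)\<rfloor>"
  note m = nat_floor_inverse_bounds[OF \<epsilon>, folded m_def]
  have "real M * real k \<le> real M * (6 * W)" using k W by (intro mult_left_mono) auto
  then have kN: "M * k \<le> N"
    using N by (simp only: of_nat_mult[symmetric] of_nat_le_iff[where 'a = real, symmetric]) (simp add: mult_ac)
  have "\<exists>\<H>. two_universal N M \<H> \<and>
      (\<forall>Q. cp Q \<le> \<alpha> / (real (size \<H>) * real M ^ T) \<longrightarrow>
         stat_dist (hashed \<H> (pmf_of_set (tuples (M * k) T))) Q \<ge> \<epsilon>)"
  \<comment> \<open>The bias is capped by \<open>k\<close> and by the collision budget. If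
    \<open>2 * k \<le> m\<close>, the budget admits \<open>d = k\<close> and whole symbols
    disappear; otherwise the budget is the tighter cap and the bias shows only through
    concentration.\<close>
  proof (cases "2 * k \<le> m")
    case True
    have "real M * L \<le> \<epsilon> * W * L" using \<epsilon>W L by (intro mult_right_mono) auto
    also note T1
    finally show ?thesis
      using M \<epsilon> \<alpha> m k kN True by (intro ex_far_family_small[where m = m]) (auto simp: L_def)
  next
    case False
    then have "k \<ge> 2" using m(1) by linarith
    then have "real k \<ge> 2" by simp
    then have "1296 * real k \<le> W" using k by simp
    with T1 show ?thesis
      using M \<epsilon> \<alpha> m k kN False by (intro ex_far_family_large[where m = m and W = W]) (auto simp: L_def)
  qed
  then obtain \<H> where \<H>: "two_universal N M \<H>"
    "\<And>Q. cp Q \<le> \<alpha> / (real (size \<H>) * real M ^ T) \<Longrightarrow>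
       stat_dist (hashed \<H> (pmf_of_set (tuples (M * k) T))) Q \<ge> \<epsilon>" by blast
  \<comment> \<open>Rounding up at most doubles \<open>T\<close>. Together with
    \<open>W \<le> 2592 * k\<close> this accounts for \<open>5184 = 2 * 2592\<close>.\<close>
  have "1 \<le> W * (\<epsilon> * L)"
    using mult_mono[of 2 "\<epsilon> * W" 1 L] \<open>2 \<le> \<epsilon> * W\<close> L by (simp add: mult_ac)
  then have "real T \<le> 2 * W * (\<epsilon> * L)" using T2 by (simp add: mult_ac)
  then have "real T / (\<epsilon> * L) \<le> 2 * W" using \<epsilon> L by (simp add: field_simps)
  also have "\<dots> \<le> 5184 * real k" using k by simp
  finally have "1 / 5184 * real M * (real T / (\<epsilon> * L)) \<le> 1 / 5184 * real M * (5184 * real k)"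
    by (intro mult_left_mono) auto
  then have "1 / 5184 * real M * real T / (\<epsilon> * log 2 (\<alpha> / \<epsilon>)) \<le> real (M * k)"
    by (simp add: L_def)
  moreover have "block_source N T (M * k) (pmf_of_set (tuples (M * k) T))"
    using M k kN by (intro block_source_uniform) auto
  ultimately show "\<exists>K \<H> X. 1 / 5184 * real M * real T / (\<epsilon> * log 2 (\<alpha> / \<epsilon>)) \<le> real K \<and>
      two_universal N M \<H> \<and> block_source N T K X \<and>
      (\<forall>Q :: (((nat \<Rightarrow> nat) \<times> nat) \<times> nat list) pmf.
         set_pmf Q \<subseteq> members \<H> \<times> tuples M T \<longrightarrow>
         cp Q \<le> \<alpha> / (real (size \<H>) * real M ^ T) \<longrightarrow>
         \<epsilon> \<le> stat_dist (hashed \<H> X) Q)"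
    using \<H> by blast
qed simp

end
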